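(* Let $l\ge 0$ be an integer and let $S$ be the $(p,m,2)$ signed graph consisting of a positive edge, to which are attached $l$ positive pendant edges and $2$ negative pendant edges at one end as well as $3$ positive pendant edges at the other end. If $l$ is odd and $l\geq 3$ then $S$ is not additively graceful.
   Context: A signed graph $S$ is a finite simple graph on $p$ vertices in which $m$ edges are specified as positive and the remaining $n$ edges are specified as negative; it is then called a $(p,m,n)$ signed graph, with sets of positive and negative edges $E^+(S)$ and $E^-(S)$. Attaching a pendant edge at a vertex $z$ means adding a new vertex of degree 1 joined to $z$. Thus $S$ has positive edges $z_1z_2$, $z_1v_i$ ($1\le i\le l$), $z_2w_i$ ($1\le i\le 3$) and negative edges $z_1u_1$, $z_1u_2$, all these vertices being distinct, and no other vertices or edges. An additively graceful labeling of a $(p,m,n)$ signed graph $S=(V,E)$ is an injective map $f:V\to\{0,1,\dots,m+\lceil\frac{n+1}{2}\rceil\}$ such that, with $f^*(uv)=f(u)+f(v)$ for $uv\in E^-(S)$ and $f^*(uv)=|f(u)-f(v)|$ for $uv\in E^+(S)$, one has $\{f^*(uv):uv\in E^-(S)\}=\{1,2,\dots,n\}$ and $\{f^*(uv):uv\in E^+(S)\}=\{1,2,\dots,m\}$. $S$ is additively graceful if it admits such a labeling. *)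

theory Defs
  imports Complex_Main
begin

record 'a signed_graph =
  verts :: "'a set"
  pos_edges :: "'a set set"
  neg_edges :: "'a set set"

definition is_signed_graph :: "'a signed_graph \<Rightarrow> nat \<Rightarrow> nat \<Rightarrow> nat \<Rightarrow> bool" where
  "is_signed_graph S p m n \<longleftrightarrow>
     finite (verts S) \<and>
     (\<forall>e \<in> pos_edges S \<union> neg_edges S. \<exists>x y. x \<in> verts S \<and> y \<in> verts S \<and> x \<noteq> y \<and> e = {x, y}) \<and>
     pos_edges S \<inter> neg_edges S = {} \<and>
     card (verts S) = p \<and> card (pos_edges S) = m \<and> card (neg_edges S) = n"

text \<open>Labels are integers, so that the difference is not truncated; the lower bound 0 on
  the labels is part of the definition.\<close>

definition additively_graceful_labeling :: "'a signed_graph \<Rightarrow> ('a \<Rightarrow> int) \<Rightarrow> bool" where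
  "additively_graceful_labeling S f \<longleftrightarrow>
     (let m = card (pos_edges S); n = card (neg_edges S) in
       inj_on f (verts S) \<and>
       f ` verts S \<subseteq> {0..int m + \<lceil>(real n + 1) / 2\<rceil>} \<and>
       {f u + f v | u v. {u, v} \<in> neg_edges S} = {1..int n} \<and>
       {\<bar>f u - f v\<bar> | u v. {u, v} \<in> pos_edges S} = {1..int m})"

definition additively_graceful :: "'a signed_graph \<Rightarrow> bool" where
  "additively_graceful S \<longleftrightarrow> (\<exists>f. additively_graceful_labeling S f)"

text \<open>A positive edge \<open>z1 z2\<close>, with \<open>a\<close> positive and \<open>b\<close> negative pendant edges attached at
  \<open>z1\<close> (pendant vertices \<open>vs\<close> and \<open>us\<close>), and \<open>c\<close> positive pendant edges at \<open>z2\<close> (pendant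
  vertices \<open>ws\<close>). This determines the graph up to the names of its vertices.\<close>

definition is_double_star :: "'a signed_graph \<Rightarrow> nat \<Rightarrow> nat \<Rightarrow> nat \<Rightarrow> bool" where
  "is_double_star S a b c \<longleftrightarrow>
     (\<exists>z1 z2 vs us ws.
        length vs = a \<and> length us = b \<and> length ws = c \<and>
        distinct ([z1, z2] @ vs @ us @ ws) \<and>
        verts S = set ([z1, z2] @ vs @ us @ ws) \<and>
        pos_edges S = {{z1, z2}} \<union> {{z1, v} | v. v \<in> set vs} \<union> {{z2, w} | w. w \<in> set ws} \<and>
        neg_edges S = {{z1, u} | u. u \<in> set us})"

lemma is_double_star_imp_is_signed_graph:
  assumes "is_double_star S a b c"
  shows "is_signed_graph S (a + b + c + 2) (a + c + 1) b"
proof -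
  obtain z1 z2 vs us ws where len: "length vs = a" "length us = b" "length ws = c"
    and dist: "distinct ([z1, z2] @ vs @ us @ ws)"
    and V: "verts S = set ([z1, z2] @ vs @ us @ ws)"
    and P: "pos_edges S = {{z1, z2}} \<union> {{z1, v} | v. v \<in> set vs} \<union> {{z2, w} | w. w \<in> set ws}"
    and N: "neg_edges S = {{z1, u} | u. u \<in> set us}"
    using assms unfolding is_double_star_def by (elim exE conjE) (rule that)
  have star: "{{z, v} | v. v \<in> set xs} = (\<lambda>v. {z, v}) ` set xs" for z :: 'a and xs
    by blast
  have card_star: "card ((\<lambda>v. {z, v}) ` set xs) = length xs" if "distinct xs" for z :: 'a and xs
    using that by (subst card_image) (auto simp: inj_on_def doubleton_eq_iff distinct_card)
  have "card (verts S) = a + b + c + 2"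
    unfolding V using distinct_card[OF dist] len by simp
  moreover have "card (neg_edges S) = b"
    unfolding N star using dist len by (simp add: card_star)
  moreover have "card (pos_edges S) = a + c + 1"
  proof -
    let ?A = "(\<lambda>v. {z1, v}) ` set vs" and ?B = "(\<lambda>v. {z2, v}) ` set ws"
    have "{z1, z2} \<notin> ?A \<union> ?B" "?A \<inter> ?B = {}"
      using dist by (auto simp: doubleton_eq_iff)
    then show ?thesis
      unfolding P star using dist len by (simp add: card_Un_disjoint card_star)
  qed
  moreover have "pos_edges S \<inter> neg_edges S = {}"
    unfolding P N using dist by (auto simp: doubleton_eq_iff)
  moreover have "\<forall>e \<in> pos_edges S \<union> neg_edges S.
      \<exists>x y. x \<in> verts S \<and> y \<in> verts S \<and> x \<noteq> y \<and> e = {x, y}"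
  proof
    fix e assume e: "e \<in> pos_edges S \<union> neg_edges S"
    have "z1 \<noteq> z2" "z1 \<notin> set vs" "z1 \<notin> set us" "z2 \<notin> set ws" using dist by auto
    consider "e = {z1, z2}" | v where "v \<in> set vs" "e = {z1, v}"
      | w where "w \<in> set ws" "e = {z2, w}" | u where "u \<in> set us" "e = {z1, u}"
      using e unfolding P N by blast
    then show "\<exists>x y. x \<in> verts S \<and> y \<in> verts S \<and> x \<noteq> y \<and> e = {x, y}"
    proof cases
      case 1
      with \<open>z1 \<noteq> z2\<close> show ?thesis unfolding V by (intro exI[of _ z1] exI[of _ z2]) simp
    next
      case (2 v)
      with \<open>z1 \<notin> set vs\<close> show ?thesis unfolding V by (intro exI[of _ z1] exI[of _ v]) auto
    next
      case (3 w)
      with \<open>z2 \<notin> set ws\<close> show ?thesis unfolding V by (intro exI[of _ z2] exI[of _ w]) auto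
    next
      case (4 u)
      with \<open>z1 \<notin> set us\<close> show ?thesis unfolding V by (intro exI[of _ z1] exI[of _ u]) auto
    qed
  qed
  moreover have "finite (verts S)" unfolding V by simp
  ultimately show ?thesis unfolding is_signed_graph_def by blast
qed

lemma ex_double_star: "\<exists>S :: nat signed_graph. is_double_star S a b c"
proof -
  define vs us ws where "vs = [2..<2+a]" and "us = [2+a..<2+a+b]" and "ws = [2+a+b..<2+a+b+c]"
  define S :: "nat signed_graph" where
    "S = \<lparr>verts = set ([0, 1] @ vs @ us @ ws),
      pos_edges = {{0, 1}} \<union> {{0, v} | v. v \<in> set vs} \<union> {{1, w} | w. w \<in> set ws},
      neg_edges = {{0, u} | u. u \<in> set us}\<rparr>"
  have "distinct ([0, 1] @ vs @ us @ ws)"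
    unfolding vs_def us_def ws_def by auto
  moreover have "length vs = a" "length us = b" "length ws = c"
    unfolding vs_def us_def ws_def by auto
  ultimately have "is_double_star S a b c"
    unfolding is_double_star_def S_def signed_graph.simps by blast
  then show ?thesis by blast
qed

end

theory Submission
  imports Defs
begin

text \<open>
  The graph has \<open>l + 7\<close> vertices and, with \<open>m = l + 4\<close> and \<open>n = 2\<close>, the largest label allowed
  is \<open>l + 6\<close>. So every label in \<open>{0..l + 6}\<close> is used exactly once, and this rigidity determines
  nearly everything.

  The two negative edges carry the sums 1 and 2. This forces the label 0 on \<open>z1\<close> and the labels
  1 and 2 on the negative leaves (lemma \<open>negative_star_sums_1_2\<close>). Since \<open>z1\<close> has label 0, the
  positive edges at \<open>z1\<close> carry the labels of their other ends, and these are at most \<open>m\<close>. Hence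
  the two large labels \<open>l + 5\<close> and \<open>l + 6\<close> sit on leaves of \<open>z2\<close>. Write \<open>b\<close> for the label of
  \<open>z2\<close> and \<open>c\<close> for that of its third leaf. The positive edges at \<open>z1\<close> realise every value in
  \<open>{3..l + 4}\<close> other than \<open>c\<close>, so the three remaining edges must produce
  \<open>{l + 5 - b, l + 6 - b, \<bar>c - b\<bar>} = {1, 2, c}\<close>.
  As \<open>c \<ge> 3\<close>, the two consecutive numbers on the left are either 1 and 2 or 2 and 3. In the
  first case \<open>b = l + 4\<close> and \<open>\<bar>c - b\<bar> = c\<close>, so \<open>l + 4 = 2 c\<close> is even. In the second case
  \<open>c = 3\<close>, \<open>b = l + 3\<close> and \<open>\<bar>c - b\<bar> = 1\<close>, so \<open>l = 1\<close>. Both are excluded for odd \<open>l \<ge> 3\<close>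
  (lemma \<open>no_label_pair_for_second_centre\<close>).
\<close>

lemma star_edge_values:
  assumes "\<And>x y. g x y = g y x"
  shows "{g u v | u v. {u, v} \<in> {{z, x} | x. x \<in> X}} = g z ` X"
proof (intro equalityI subsetI)
  fix t assume "t \<in> {g u v | u v. {u, v} \<in> {{z, x} | x. x \<in> X}}"
  then obtain u v x where "t = g u v" "{u, v} = {z, x}" "x \<in> X" by blast
  then show "t \<in> g z ` X" using assms by (auto simp: doubleton_eq_iff)
qed blast

lemma edge_values_Un:
  "{g u v | u v. {u, v} \<in> E \<union> F} = {g u v | u v. {u, v} \<in> E} \<union> {g u v | u v. {u, v} \<in> F}"
  by blast

text \<open>As labels are nonnegative, the edge with sum 1 leaves only 0 and 1 for the centre. A
  centre labelled 1 would share its label with the leaf on the edge with sum 2.\<close>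

lemma negative_star_sums_1_2:
  fixes a :: int
  assumes "(+) a ` U = {1, 2}" and "a \<notin> U" and "0 \<le> a" and "\<And>u. u \<in> U \<Longrightarrow> 0 \<le> u"
  shows "a = 0" and "U = {1, 2}"
proof -
  have "U = (\<lambda>y. y - a) ` ((+) a ` U)" by (simp add: image_image)
  then have U: "U = {1 - a, 2 - a}" by (simp add: assms(1))
  have "a \<le> 1" using assms(4)[of "1 - a"] U by simp
  moreover have "a \<noteq> 1" using U assms(2) by auto
  ultimately show "a = 0" using assms(3) by linarith
  with U show "U = {1, 2}" by simp
qed

lemma card_3_obtain_third:
  assumes "card W = 3" "x \<in> W" "y \<in> W" "x \<noteq> y"
  obtains c where "W = {x, y, c}" "c \<noteq> x" "c \<noteq> y"
proof -
  have "finite W" using assms(1) by (metis card.infinite zero_neq_numeral)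
  then have "card (W - {x, y}) = 1" using assms by (simp add: card_Diff_subset)
  then obtain c where "W - {x, y} = {c}" by (meson card_1_singletonE)
  then have "W = {x, y, c}" "c \<noteq> x" "c \<noteq> y" using assms by auto
  then show thesis by (rule that)
qed

text \<open>Here \<open>b\<close> and \<open>c\<close> are the labels of \<open>z2\<close> and of its smallest leaf; the assumption says
  that the edges from \<open>z2\<close> to its leaves supply the three differences still missing.\<close>

lemma no_label_pair_for_second_centre:
  fixes b c :: int and l :: nat
  assumes "{1, 2, c} \<subseteq> {int l + 5 - b, int l + 6 - b, \<bar>c - b\<bar>}"
    and "3 \<le> b" "3 \<le> c" and "odd l" "l \<ge> 3"
  shows False
proof -
  have 1: "1 = int l + 5 - b \<or> 1 = int l + 6 - b \<or> 1 = \<bar>c - b\<bar>"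
    and 2: "2 = int l + 5 - b \<or> 2 = int l + 6 - b \<or> 2 = \<bar>c - b\<bar>"
    and 3: "c = int l + 5 - b \<or> c = int l + 6 - b \<or> c = \<bar>c - b\<bar>"
    using assms(1) by auto
  have "int l + 4 \<noteq> 2 * c"
  proof
    assume "int l + 4 = 2 * c"
    then have "even (int l)" by presburger
    with \<open>odd l\<close> show False by simp
  qed
  then show False using 1 2 3 assms(2,3,5) by linarith
qed

text \<open>The purely numerical form of the theorem: \<open>b\<close> is the label of \<open>z2\<close>, and \<open>A\<close> and \<open>W\<close> are
  the sets of labels of the positive leaves at \<open>z1\<close> and at \<open>z2\<close>, while \<open>z1\<close> and its negative
  leaves have the labels 0, 1 and 2.\<close>

lemma no_double_star_labels:
  fixes A W :: "int set" and b :: int and l :: nat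
  assumes labels: "{0, b, 1, 2} \<union> A \<union> W = {0..int l + 6}"
    and b: "b \<notin> {0, 1, 2}" and W: "card W = 3" "W \<inter> ({0, b, 1, 2} \<union> A) = {}"
    and A: "A \<inter> {1, 2} = {}"
    and diffs: "{b} \<union> A \<union> (\<lambda>w. \<bar>b - w\<bar>) ` W = {1..int l + 4}"
    and l: "odd l" "l \<ge> 3"
  shows False
proof -
  have small: "b \<le> int l + 4" "\<And>x. x \<in> A \<Longrightarrow> x \<le> int l + 4"
    using diffs by auto
  have large: "k \<in> W" if "int l + 4 < k" "k \<le> int l + 6" for k
  proof -
    have "k \<in> {0, b, 1, 2} \<union> A \<union> W" using labels that by auto
    then show ?thesis using that small l(2) by force
  qed
  obtain c where c: "W = {int l + 5, int l + 6, c}" "c \<noteq> int l + 5" "c \<noteq> int l + 6"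
    by (rule card_3_obtain_third[OF W(1) large large, of "int l + 5" "int l + 6"]) auto
  have bounds: "b \<in> {0..int l + 6}" "c \<in> {0..int l + 6}" using labels c(1) by auto
  have "c \<notin> {0, 1, 2}" using c(1) W(2) by auto
  with bounds(2) have "3 \<le> c" by auto
  moreover have "c \<le> int l + 4" using bounds(2) c(2,3) by auto
  moreover have "3 \<le> b" using bounds(1) b by auto
  ultimately have bc: "3 \<le> b" "3 \<le> c" "c \<le> int l + 4" by blast+
  \<comment> \<open>The numbers 1, 2 and \<open>c\<close> are differences but not labels of neighbours of \<open>z1\<close> along
    positive edges.\<close>
  have "{1, 2, c} \<subseteq> {1..int l + 4}" using bc by auto
  then have "{1, 2, c} \<subseteq> {b} \<union> A \<union> (\<lambda>w. \<bar>b - w\<bar>) ` W" by (simp only: diffs)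
  moreover have "{1, 2, c} \<inter> ({b} \<union> A) = {}" using A W(2) c(1) bc by auto
  ultimately have "{1, 2, c} \<subseteq> (\<lambda>w. \<bar>b - w\<bar>) ` W" by blast
  also have "\<dots> = {int l + 5 - b, int l + 6 - b, \<bar>c - b\<bar>}"
    using small(1) by (simp add: c(1) abs_minus_commute)
  finally show False using no_label_pair_for_second_centre bc l by blast
qed

theorem theorem4p3:
  fixes S :: "'a signed_graph" and l p m :: nat
  assumes "is_signed_graph S p m 2"
    and "is_double_star S l 2 3"
    and "odd l" and "l \<ge> 3"
  shows "\<not> additively_graceful S"
proof
  assume "additively_graceful S"
  then obtain f where f: "additively_graceful_labeling S f"
    unfolding additively_graceful_def by blast
  obtain z1 z2 vs us ws where len: "length vs = l" "length us = 2" "length ws = 3"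
    and dist: "distinct ([z1, z2] @ vs @ us @ ws)"
    and V: "verts S = set ([z1, z2] @ vs @ us @ ws)"
    and P: "pos_edges S = {{z1, z2}} \<union> {{z1, v} | v. v \<in> set vs} \<union> {{z2, w} | w. w \<in> set ws}"
    and N: "neg_edges S = {{z1, u} | u. u \<in> set us}"
    using assms(2) unfolding is_double_star_def by (elim exE conjE) (rule that)
  have cards: "card (verts S) = l + 7" "card (pos_edges S) = l + 4" "card (neg_edges S) = 2"
    using is_double_star_imp_is_signed_graph[OF assms(2)] unfolding is_signed_graph_def
    by simp_all
  have "\<lceil>(real 2 + 1) / 2\<rceil> = 2" by (simp add: ceiling_eq_iff)
  then have top: "int (l + 4) + \<lceil>(real 2 + 1) / 2\<rceil> = int l + 6" by linarith
  have inj: "inj_on f (verts S)"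
    and range: "f ` verts S \<subseteq> {0..int l + 6}"
    and sums: "{f u + f v | u v. {u, v} \<in> neg_edges S} = {1..2}"
    and diffs: "{\<bar>f u - f v\<bar> | u v. {u, v} \<in> pos_edges S} = {1..int l + 4}"
    using f unfolding additively_graceful_labeling_def Let_def cards top by simp_all

  \<comment> \<open>There are as many vertices as labels.\<close>
  have onto: "f ` verts S = {0..int l + 6}"
    using range inj cards(1) by (intro card_subset_eq) (auto simp: card_image)

  define U A W where "U = f ` set us" and "A = f ` set vs" and "W = f ` set ws"
  have labels: "f ` verts S = {f z1, f z2} \<union> U \<union> A \<union> W"
    unfolding V U_def A_def W_def by auto
  have inj': "f x = f y \<longleftrightarrow> x = y" if "x \<in> verts S" "y \<in> verts S" for x y
    using inj that by (rule inj_on_eq_iff)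
  have disj: "f z1 \<notin> U" "f z2 \<notin> {f z1} \<union> U" "A \<inter> U = {}" "W \<inter> ({f z1, f z2} \<union> U \<union> A) = {}"
    using dist unfolding U_def A_def W_def by (auto simp: inj' V)
  have "card W = 3"
    unfolding W_def using dist len(3) inj V
    by (subst card_image) (auto simp: distinct_card intro: inj_on_subset)

  have "(+) (f z1) ` U = {1..2}"
    using star_edge_values[of "\<lambda>u v. f u + f v" z1 "set us"] sums
    unfolding N U_def image_image by (simp add: add.commute)
  moreover have "{1..2} = {1, 2 :: int}" by auto
  ultimately have "(+) (f z1) ` U = {1, 2}" by simp
  moreover have "0 \<le> f z1" "\<And>u. u \<in> U \<Longrightarrow> 0 \<le> u" using range labels by auto
  ultimately have centre: "f z1 = 0" and leaves: "U = {1, 2}"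
    using negative_star_sums_1_2[OF _ disj(1)] by blast+

  have "pos_edges S = {{z1, x} | x. x \<in> {z2} \<union> set vs} \<union> {{z2, w} | w. w \<in> set ws}"
    unfolding P by auto
  then have "{\<bar>f u - f v\<bar> | u v. {u, v} \<in> pos_edges S}
      = {\<bar>f u - f v\<bar> | u v. {u, v} \<in> {{z1, x} | x. x \<in> {z2} \<union> set vs}}
        \<union> {\<bar>f u - f v\<bar> | u v. {u, v} \<in> {{z2, w} | w. w \<in> set ws}}"
    by (simp only: edge_values_Un)
  also have "\<dots> = (\<lambda>x. \<bar>f z1 - f x\<bar>) ` ({z2} \<union> set vs) \<union> (\<lambda>w. \<bar>f z2 - f w\<bar>) ` set ws"
    using star_edge_values[of "\<lambda>u v. \<bar>f u - f v\<bar>", OF abs_minus_commute] by (simp only:)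
  also have "(\<lambda>x. \<bar>f z1 - f x\<bar>) ` ({z2} \<union> set vs) = f ` ({z2} \<union> set vs)"
    using range unfolding V centre by (intro image_cong) auto
  finally have "{f z2} \<union> A \<union> (\<lambda>w. \<bar>f z2 - w\<bar>) ` W = {1..int l + 4}"
    unfolding diffs A_def W_def by (simp add: image_image)
  moreover have "{0, f z2, 1, 2} \<union> A \<union> W = {0..int l + 6}"
    using onto unfolding labels centre leaves by auto
  ultimately show False
    using no_double_star_labels[of "f z2" A W l] disj \<open>card W = 3\<close> assms(3,4)
    unfolding centre leaves by auto
qed

end
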